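(* Let $\Omega_i^{(j)}$ be a subset at level $j$ of a refinement chain. For $s$ with $\bm\omega^s\in\Omega_i^{(j)}$ and an extreme ray $\bm r\in\mathbb R^p$ of $\Lambda^s$, with associated feasibility cut $(\bm h^s-\bm T^s\bm x)^\top\bm r\le0$, put $$\bm r^s:=(\bm b^s\otimes\bm I_p)\,\bm r,$$ where $\bm b^s$ is the standard basis vector of $\mathbb R^{|\Omega_i^{(j)}|}$ associated with scenario $s$, $\bm I_p$ is the $p\times p$ identity matrix and $\otimes$ is the Kronecker product. Then the extreme rays of $\Lambda_i^{(j)}$ are the vectors of the form $\bm r^s$, with $s$ such that $\bm\omega^s\in\Omega_i^{(j)}$ and $\bm r$ an extreme ray of $\Lambda^s$. Moreover, the feasibility cut $(\bm h_i^{(j)}-\bm T_i^{(j)}\bm x)^\top\bm r^s\le0$ associated with $\bm r^s$ coincides with the feasibility cut $(\bm h^s-\bm T^s\bm x)^\top\bm r\le0$.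
   Context: Scenarios $\Omega=\{\bm\omega^1,\dots,\bm\omega^{|\mathcal S|}\}$, $\mathcal S=\{1,\dots,|\mathcal S|\}$, with probability measure $\mathbb P$, $p^s=\mathbb P(\bm\omega^s)>0$; $\bm W\in\mathbb R^{p\times m}$, $\bm T^s\in\mathbb R^{p\times n}$, $\bm h^s\in\mathbb R^p$, $\bm q^s\in\mathbb R^m$; $\bm x\in\mathbb R^n$ is the first-stage variable. Refinement chain. For each level $j=1,\dots,J$ there is a collection $\{\Omega_i^{(j)}\}_{i=1}^{m_j}$ of nonempty subsets of $\Omega$, with $m_J=1$, $\Omega_1^{(J)}=\Omega$, covering $\Omega$ at each level, such that for $j\ge2$ each $\Omega_i^{(j)}$ is a union of sets of level $j-1$. Each $\Omega_i^{(j)}$ carries a probability measure $\mathbb P_i^{(j)}$ with support $\Omega_i^{(j)}$ (and $\mathbb P_1^{(J)}=\mathbb P$), such that $\mathbb P$ is a convex combination of the $\mathbb P_i^{(j)}$ at each level, and each $\mathbb P_i^{(j)}$, $j\ge2$, is a convex combination of the measures of the level $j-1$ sets composing $\Omega_i^{(j)}$. Write $p^s_{\Omega_i^{(j)}}:=\mathbb P_i^{(j)}(\bm\omega^s)$, which is positive for $\bm\omega^s\in\Omega_i^{(j)}$. Dual objects. $\Lambda^s=\{\bm\lambda\in\mathbb R^p:\bm W^\top\bm\lambda\le\bm q^s\}$, assumed nonempty; $\Lambda_i^{(j)}=\prod_{s:\bm\omega^s\in\Omega_i^{(j)}}\{\bm\lambda^s\in\mathbb R^p:\bm W^\top\bm\lambda^s\le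 p^s_{\Omega_i^{(j)}}\bm q^s\}\subseteq\mathbb R^{p|\Omega_i^{(j)}|}$; $\bm h_i^{(j)}$, $\bm T_i^{(j)}$ are the stackings of $\bm h^s$, $\bm T^s$ over $s$ with $\bm\omega^s\in\Omega_i^{(j)}$. Thus $\bm r^s$ has block $\bm r$ in the position of scenario $s$ and zero in all other blocks. Extreme rays are understood up to multiplication by positive scalars; the extreme rays of a nonempty polyhedron are those of its recession cone. *)

theory Defs
  imports "HOL-Analysis.Analysis" "HOL-Probability.Probability_Mass_Function"
begin

text \<open>The scenarios form a finite type \<open>'s\<close>, a scenario being identified with its index; thus
  \<open>\<Omega>\<close> is \<open>UNIV\<close>.\<close>

definition pmf_convex_comb :: "'s pmf \<Rightarrow> nat set \<Rightarrow> (nat \<Rightarrow> 's pmf) \<Rightarrow> bool" where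
  "pmf_convex_comb P I Q \<longleftrightarrow>
     (\<exists>w :: nat \<Rightarrow> real. (\<forall>i\<in>I. 0 \<le> w i) \<and> (\<Sum>i\<in>I. w i) = 1 \<and>
        (\<forall>s. pmf P s = (\<Sum>i\<in>I. w i * pmf (Q i) s)))"

text \<open>\<open>\<Omega> j i\<close> and \<open>Q j i\<close> are the \<open>i\<close>-th set of level \<open>j\<close> and its measure, for
  \<open>j \<in> {1..J}\<close> and \<open>i \<in> {1..m j}\<close>; other index values carry no information. In the last
  assumption the same index set \<open>I\<close> decomposes both the set and its measure.\<close>

locale refinement_chain =
  fixes P :: "'s::finite pmf"
    and J :: nat
    and m :: "nat \<Rightarrow> nat"
    and \<Omega> :: "nat \<Rightarrow> nat \<Rightarrow> 's set"
    and Q :: "nat \<Rightarrow> nat \<Rightarrow> 's pmf"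
  assumes full_support: "set_pmf P = UNIV"
    and levels: "1 \<le> J"
    and top_level: "m J = 1" "\<Omega> J 1 = UNIV" "Q J 1 = P"
    and nonempty: "\<lbrakk>j \<in> {1..J}; i \<in> {1..m j}\<rbrakk> \<Longrightarrow> \<Omega> j i \<noteq> {}"
    and covering: "j \<in> {1..J} \<Longrightarrow> (\<Union>i\<in>{1..m j}. \<Omega> j i) = UNIV"
    and support: "\<lbrakk>j \<in> {1..J}; i \<in> {1..m j}\<rbrakk> \<Longrightarrow> set_pmf (Q j i) = \<Omega> j i"
    and mixture: "j \<in> {1..J} \<Longrightarrow> pmf_convex_comb P {1..m j} (Q j)"
    and refinement: "\<lbrakk>j \<in> {2..J}; i \<in> {1..m j}\<rbrakk> \<Longrightarrow>
      \<exists>I \<subseteq> {1..m (j - 1)}. \<Omega> j i = (\<Union>k\<in>I. \<Omega> (j - 1) k) \<and>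
        pmf_convex_comb (Q j i) I (Q (j - 1))"

text \<open>For a nonempty closed convex \<open>C\<close> this is the usual recession cone.\<close>

definition recession_cone :: "'a::real_vector set \<Rightarrow> 'a set" where
  "recession_cone C = {d. \<forall>x\<in>C. \<forall>t\<ge>0. x + t *\<^sub>R d \<in> C}"

text \<open>A vector is an extreme ray if it generates a half-line face of the recession cone. This
  includes every positive multiple of such a vector, so an equality between sets of extreme rays
  expresses equality up to positive scaling. If the recession cone contains a line, there are no
  extreme rays.\<close>

definition extreme_ray :: "'a::real_vector set \<Rightarrow> 'a \<Rightarrow> bool" where
  "extreme_ray C r \<longleftrightarrow> r \<noteq> 0 \<and> {t *\<^sub>R r | t. 0 \<le> t} face_of recession_cone C"

definition dual_polyhedron :: "real^'m^'p \<Rightarrow> real^'m \<Rightarrow> (real^'p) set" where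
  "dual_polyhedron W q = {\<mu>. transpose W *v \<mu> \<le> q}"

text \<open>Stacking over a set \<open>A\<close> of scenarios: the blocks are indexed by a finite type \<open>'b\<close>, and the
  bijection \<open>e\<close> from \<open>'b\<close> onto \<open>A\<close> gives the scenario sitting in each block. The vectors
  in \<open>real^('b \<times> 'p)\<close> are those of dimension \<open>p |A|\<close>, with component \<open>(b, k)\<close> the \<open>k\<close>-th entry of
  block \<open>b\<close>.\<close>

definition block :: "'b::finite \<Rightarrow> 'a^('b \<times> 'p::finite) \<Rightarrow> 'a^'p" where
  "block b v = (\<chi> k. v $ (b, k))"

definition stack :: "('b::finite \<Rightarrow> 's) \<Rightarrow> ('s \<Rightarrow> 'a^'p::finite) \<Rightarrow> 'a^('b \<times> 'p)" where
  "stack e f = (\<chi> bk. f (e (fst bk)) $ snd bk)"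

definition group_dual_polyhedron ::
    "real^'m^'p \<Rightarrow> ('s \<Rightarrow> real^'m) \<Rightarrow> 's pmf \<Rightarrow> ('b \<Rightarrow> 's) \<Rightarrow> (real^('b::finite \<times> 'p::finite)) set"
where
  "group_dual_polyhedron W q Q e =
     {\<mu>. \<forall>b. transpose W *v block b \<mu> \<le> pmf Q (e b) *\<^sub>R q (e b)}"

text \<open>The Kronecker product of \<open>u\<close>, as a one-column matrix, with \<open>M\<close>.\<close>

definition kron_vec :: "real^'b::finite \<Rightarrow> real^'l^'k::finite \<Rightarrow> real^'l^('b \<times> 'k)" where
  "kron_vec u M = (\<chi> bk. \<chi> l. u $ fst bk * M $ snd bk $ l)"

definition lift_ray :: "('b::finite \<Rightarrow> 's) \<Rightarrow> 's \<Rightarrow> real^'p::finite \<Rightarrow> real^('b \<times> 'p)" where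
  "lift_ray e s r = kron_vec (axis (inv e s) 1) (mat 1) *v r"

definition feasibility_cut :: "real^'k \<Rightarrow> real^'n^'k \<Rightarrow> real^'k \<Rightarrow> (real^'n) set" where
  "feasibility_cut h T r = {x. (h - T *v x) \<bullet> r \<le> 0}"

end

theory Submission
  imports Defs
begin

text \<open>The recession cone of \<open>\<Lambda>\<^sub>i\<^sup>(\<^sup>j\<^sup>)\<close> is the product, over the blocks, of copies of the cone
  \<open>K = {d. W\<^sup>T d \<le> 0}\<close>, because the right-hand sides of a feasible system of inequalities do not
  affect its recession directions. A point of a product of convex cones is the sum of its blocks,
  so a point on an extreme ray has a single nonzero block, which lies on an extreme ray of \<open>K\<close>.
  Conversely, if a sum of two points of the product lies on a lifted extreme ray of \<open>K\<close>, then in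
  every other block the two summands are opposite elements of \<open>K\<close>; as \<open>K\<close> has an extreme ray,
  it contains no line, and these blocks vanish.\<close>

section \<open>Extreme rays and recession cones of polyhedra\<close>

lemma recession_cone_scaleR:
  assumes "x \<in> recession_cone C" "0 \<le> t"
  shows "t *\<^sub>R x \<in> recession_cone C"
  using assms by (simp add: recession_cone_def)

lemma half_line_scaleR:
  fixes x r :: "'a::real_vector"
  assumes "t *\<^sub>R x \<in> {u *\<^sub>R r | u. 0 \<le> u}" "0 < t"
  shows "x \<in> {u *\<^sub>R r | u. 0 \<le> u}"
proof -
  obtain u where u: "0 \<le> u" "t *\<^sub>R x = u *\<^sub>R r"
    using assms by blast
  have "x = inverse t *\<^sub>R (t *\<^sub>R x)"
    using assms by simp
  also have "\<dots> = (u / t) *\<^sub>R r"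
    unfolding u by (simp add: divide_inverse_commute)
  finally show ?thesis
    using u assms by auto
qed

text \<open>Since the recession cone is closed under nonnegative scaling, open segments may be
  traded for sums: \<open>x + y\<close> is the midpoint of \<open>2 *\<^sub>R x\<close> and
  \<open>2 *\<^sub>R y\<close>, and a convex combination is a sum of two scaled members. Sums pass
  to blocks more easily than segments. A conclusion about \<open>x\<close> alone suffices, as the
  two summands can be exchanged.\<close>

lemma extreme_ray_iff_sum:
  "extreme_ray C r \<longleftrightarrow> r \<noteq> 0 \<and> r \<in> recession_cone C \<and>
     (\<forall>x\<in>recession_cone C. \<forall>y\<in>recession_cone C.
        x + y \<in> {t *\<^sub>R r | t. 0 \<le> t} \<longrightarrow> x \<in> {t *\<^sub>R r | t. 0 \<le> t})"
proof -
  define K where "K = recession_cone C"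
  define R where "R = {t *\<^sub>R r | t. 0 \<le> t}"
  have "r \<in> R"
    unfolding R_def by (auto intro!: exI[of _ 1])
  have cancel: "x \<in> R" if "t *\<^sub>R x \<in> R" "0 < t" for x t
    using that half_line_scaleR unfolding R_def by blast
  have "R face_of K \<longleftrightarrow> r \<in> K \<and> (\<forall>x\<in>K. \<forall>y\<in>K. x + y \<in> R \<longrightarrow> x \<in> R)"
  proof (intro iffI conjI ballI impI)
    assume face: "R face_of K"
    then show "r \<in> K"
      using \<open>r \<in> R\<close> face_of_imp_subset by blast
    fix x y
    assume xy: "x \<in> K" "y \<in> K" "x + y \<in> R"
    show "x \<in> R"
    \<comment> \<open>Equal endpoints have an empty open segment, so the face property says nothing
      about them.\<close>
    proof (cases "x = y")
      case True
      then show ?thesis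
        using xy cancel[of 2 x] by (simp add: scaleR_2)
    next
      case False
      have "x + y = (1 - 1 / 2) *\<^sub>R (2 *\<^sub>R x) + (1 / 2) *\<^sub>R (2 *\<^sub>R y)"
        by simp
      then have "x + y \<in> open_segment (2 *\<^sub>R x) (2 *\<^sub>R y)"
        using False unfolding in_segment by (intro conjI exI[of _ "1 / 2"]) auto
      moreover have "2 *\<^sub>R x \<in> K" "2 *\<^sub>R y \<in> K"
        using xy by (simp_all add: K_def recession_cone_scaleR)
      ultimately have "2 *\<^sub>R x \<in> R"
        using face xy(3) unfolding face_of_def by blast
      then show ?thesis
        by (rule cancel) simp
    qed
  next
    assume *: "r \<in> K \<and> (\<forall>x\<in>K. \<forall>y\<in>K. x + y \<in> R \<longrightarrow> x \<in> R)"
    have "R \<subseteq> K"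
      using * by (auto simp: R_def K_def recession_cone_scaleR)
    moreover have "convex R"
    proof -
      have "R = (\<lambda>t. t *\<^sub>R r) ` {0..}"
        by (auto simp: R_def)
      then show ?thesis
        by (simp add: convex_linear_image linear_scale_left)
    qed
    moreover have "a \<in> R \<and> b \<in> R"
      if ab: "a \<in> K" "b \<in> K" and z: "z \<in> R" "z \<in> open_segment a b" for a b z
    proof -
      obtain u where u: "0 < u" "u < 1" "z = (1 - u) *\<^sub>R a + u *\<^sub>R b"
        using z(2) by (auto simp: in_segment)
      have "(1 - u) *\<^sub>R a \<in> K" "u *\<^sub>R b \<in> K"
        using ab u by (simp_all add: K_def recession_cone_scaleR)
      \<comment> \<open>Both orders are recorded because the sum condition only yields the first
        summand.\<close>
      moreover have "(1 - u) *\<^sub>R a + u *\<^sub>R b \<in> R" "u *\<^sub>R b + (1 - u) *\<^sub>R a \<in> R"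
        using z(1) u(3) by (simp_all add: add.commute)
      ultimately have "(1 - u) *\<^sub>R a \<in> R" "u *\<^sub>R b \<in> R"
        using * by blast+
      then show ?thesis
        using cancel u by (meson diff_gt_0_iff_gt)
    qed
    ultimately show "R face_of K"
      unfolding face_of_def by blast
  qed
  then show ?thesis
    unfolding extreme_ray_def K_def R_def by simp
qed

text \<open>From a feasible point, a direction along which some \<open>f a\<close> increases
  eventually violates the bound \<open>c a\<close>. If the system were infeasible, every direction
  would be a recession direction, hence the nonemptiness assumption.\<close>

lemma recession_cone_linear_inequalities:
  assumes lin: "\<And>a. linear (f a :: 'a::real_vector \<Rightarrow> real)"
    and nonempty: "{x. \<forall>a. f a x \<le> c a} \<noteq> {}"
  shows "recession_cone {x. \<forall>a. f a x \<le> c a} = {d. \<forall>a. f a d \<le> 0}"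
proof (intro equalityI subsetI CollectI allI)
  fix d a
  assume d: "d \<in> recession_cone {x. \<forall>a. f a x \<le> c a}"
  obtain x where x: "\<forall>a. f a x \<le> c a"
    using nonempty by blast
  have bound: "f a x + t * f a d \<le> c a" if "0 \<le> t" for t
  proof -
    have "f a (x + t *\<^sub>R d) \<le> c a"
      using d x that by (simp add: recession_cone_def)
    then show ?thesis
      by (simp add: linear_add[OF lin] linear_scale[OF lin])
  qed
  show "f a d \<le> 0"
  proof (rule ccontr)
    assume "\<not> f a d \<le> 0"
    moreover have "0 \<le> c a - f a x"
      using x by simp
    \<comment> \<open>At this value of \<open>t\<close> the left-hand side of \<open>bound\<close>
      equals \<open>c a + 1\<close>.\<close>
    ultimately show False
      using bound[of "(c a - f a x + 1) / f a d"] by simp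
  qed
next
  fix d
  assume "d \<in> {d. \<forall>a. f a d \<le> 0}"
  then show "d \<in> recession_cone {x. \<forall>a. f a x \<le> c a}"
    by (auto simp: recession_cone_def linear_add[OF lin] linear_scale[OF lin]
        intro!: add_decreasing2 mult_nonneg_nonpos)
qed

lemma recession_cone_dual_polyhedron:
  assumes "dual_polyhedron W q \<noteq> {}"
  shows "recession_cone (dual_polyhedron W q) = {d. transpose W *v d \<le> 0}"
proof -
  have eq: "dual_polyhedron W q' = {\<mu>. \<forall>l. (transpose W *v \<mu>) $ l \<le> q' $ l}" for q'
    by (simp add: dual_polyhedron_def less_eq_vec_def)
  have lin: "linear (\<lambda>\<mu>. (transpose W *v \<mu>) $ l)" for l
    by (auto intro!: linearI simp: matrix_vector_right_distrib matrix_vector_mult_scaleR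
        simp del: transpose_matrix_vector)
  show ?thesis
    using recession_cone_linear_inequalities[OF lin, where c = "\<lambda>l. q $ l"] assms
    by (simp add: eq less_eq_vec_def)
qed

section \<open>Block calculus\<close>

lemma block_add: "block b (v + w) = block b v + block b w"
  by (simp add: block_def vec_eq_iff)

lemma block_diff: "block b (v - w) = block b v - block b w"
  by (simp add: block_def vec_eq_iff)

lemma block_scaleR: "block b (t *\<^sub>R v) = t *\<^sub>R block b v"
  by (simp add: block_def vec_eq_iff)

lemma block_zero: "block b 0 = 0"
  by (simp add: block_def vec_eq_iff)

lemma block_eq_iff: "v = w \<longleftrightarrow> (\<forall>b. block b v = block b w)"
  by (auto simp: block_def vec_eq_iff)

lemma block_stack: "block b (stack e f) = f (e b)"
  by (simp add: block_def stack_def vec_eq_iff)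

lemma block_stack_mult: "block b (stack e T *v x) = T (e b) *v x"
  by (simp add: block_def stack_def matrix_vector_mult_def vec_eq_iff)

lemma inner_blocks: "v \<bullet> w = (\<Sum>b\<in>UNIV. block b v \<bullet> block b w)"
  for v w :: "real^('b::finite \<times> 'p::finite)"
  by (simp add: inner_vec_def block_def sum.cartesian_product UNIV_Times_UNIV[symmetric]
      del: UNIV_Times_UNIV)

lemma block_kron_axis:
  "block c (kron_vec (axis b 1) (mat 1) *v r) = (if c = b then r else 0)"
  by (auto simp: block_def kron_vec_def matrix_vector_mult_def vec_eq_iff axis_def mat_def
      if_distrib[of "\<lambda>x. x * _"] cong: if_cong)

text \<open>Injectivity gives \<open>inv e (e b) = b\<close>, so the basis vector in
  \<open>lift_ray\<close> selects the block \<open>b\<close>.\<close>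

lemma block_lift_ray:
  assumes "inj e"
  shows "block c (lift_ray e (e b) r) = (if c = b then r else 0)"
  using assms by (simp add: lift_ray_def block_kron_axis)

section \<open>Recession cone and extreme rays of the product polyhedron\<close>

lemma recession_cone_group_dual_polyhedron:
  fixes W :: "real^'m^'p" and e :: "'b::finite \<Rightarrow> 's"
  assumes "\<And>s. dual_polyhedron W (q s) \<noteq> {}"
  shows "recession_cone (group_dual_polyhedron W q Q e) =
    {d. \<forall>b. transpose W *v block b d \<le> 0}"
proof -
  \<comment> \<open>Indexing the scalar inequalities by pairs of a block and a row turns the product
    into a single linear system.\<close>
  define f where "f = (\<lambda>(b :: 'b, l) \<mu>. (transpose W *v block b \<mu>) $ l)"
  define c where "c = (\<lambda>(b, l). pmf Q (e b) * q (e b) $ l)"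
  have eq: "group_dual_polyhedron W q Q e = {\<mu>. \<forall>a. f a \<mu> \<le> c a}"
    by (simp add: group_dual_polyhedron_def less_eq_vec_def f_def c_def)
  have lin: "linear (f a)" for a
    by (cases a, auto intro!: linearI simp: f_def block_add block_scaleR
        matrix_vector_right_distrib matrix_vector_mult_scaleR
        simp del: transpose_matrix_vector)
  have "\<exists>\<mu>. \<mu> \<in> dual_polyhedron W (q s)" for s
    using assms by blast
  then obtain \<mu> where \<mu>: "\<mu> s \<in> dual_polyhedron W (q s)" for s
    by metis
  \<comment> \<open>Scaling a point of each scenario polyhedron by the nonnegative probability of
    the scenario gives a feasible point of the product.\<close>
  have "stack e (\<lambda>s. pmf Q s *\<^sub>R \<mu> s) \<in> group_dual_polyhedron W q Q e"
    using \<mu> by (auto simp: group_dual_polyhedron_def dual_polyhedron_def block_stack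
        matrix_vector_mult_scaleR less_eq_vec_def simp del: transpose_matrix_vector intro!: mult_left_mono)
  then have "{\<mu>. \<forall>a. f a \<mu> \<le> c a} \<noteq> {}"
    unfolding eq by blast
  from recession_cone_linear_inequalities[OF lin this] show ?thesis
    unfolding eq by (simp add: f_def less_eq_vec_def)
qed

lemma extreme_ray_group_dual_polyhedron_iff:
  fixes W :: "real^'m^'p" and e :: "'b::finite \<Rightarrow> 's"
  assumes nonempty: "\<And>s. dual_polyhedron W (q s) \<noteq> {}" and inj: "inj e"
  shows "extreme_ray (group_dual_polyhedron W q Q e) \<rho> \<longleftrightarrow>
    (\<exists>b r. \<rho> = lift_ray e (e b) r \<and> extreme_ray (dual_polyhedron W (q (e b))) r)"
proof -
  define K where "K = {d. transpose W *v d \<le> 0}"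
  define G where "G = {d. \<forall>b :: 'b. block b d \<in> K}"
  define L :: "'b \<Rightarrow> real^'p \<Rightarrow> real^('b \<times> 'p)" where "L b = lift_ray e (e b)" for b
  have block_L: "block c (L b r) = (if c = b then r else 0)" for b c r
    using inj by (simp add: L_def block_lift_ray)
  have rec: "recession_cone (dual_polyhedron W (q s)) = K" for s
    using nonempty by (simp add: recession_cone_dual_polyhedron K_def)
  have rec_group: "recession_cone (group_dual_polyhedron W q Q e) = G"
    using nonempty by (simp add: recession_cone_group_dual_polyhedron G_def K_def)
  have zero: "0 \<in> K"
    by (simp add: K_def)
  then have L_mem: "L b x \<in> G \<longleftrightarrow> x \<in> K" for b x
    by (auto simp: G_def block_L)
  show ?thesis
  proof
    assume "extreme_ray (group_dual_polyhedron W q Q e) \<rho>"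
    then have nz: "\<rho> \<noteq> 0" and mem: "\<rho> \<in> G"
      and sum: "\<forall>x\<in>G. \<forall>y\<in>G. x + y \<in> {t *\<^sub>R \<rho> | t. 0 \<le> t} \<longrightarrow>
        x \<in> {t *\<^sub>R \<rho> | t. 0 \<le> t}"
      unfolding extreme_ray_iff_sum rec_group by blast+
    have split: "\<exists>t\<ge>0. x = t *\<^sub>R \<rho>"
      if "x \<in> G" "y \<in> G" "x + y = u *\<^sub>R \<rho>" "0 \<le> u" for x y u
      using sum that by fast
    obtain b where b: "block b \<rho> \<noteq> 0"
      using nz by (auto simp: block_eq_iff[of \<rho> 0] block_zero)
    define r where "r = block b \<rho>"
    have "r \<in> K"
      using mem by (simp add: G_def r_def)
    \<comment> \<open>This difference is \<open>\<rho>\<close> with block \<open>b\<close> erased,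
      so \<open>\<rho>\<close> splits inside \<open>G\<close> into its block \<open>b\<close> and
      the rest.\<close>
    have "\<rho> - L b r \<in> G"
      using mem zero by (auto simp: G_def block_diff block_L r_def)
    then obtain t where t: "L b r = t *\<^sub>R \<rho>"
      using split[of "L b r" "\<rho> - L b r" 1] \<open>r \<in> K\<close> L_mem by auto
    \<comment> \<open>In block \<open>b\<close>, both \<open>L b r\<close> and \<open>\<rho>\<close>
      equal \<open>r\<close>, which is nonzero; this fixes the factor.\<close>
    have "t *\<^sub>R r = 1 *\<^sub>R r"
      using arg_cong[OF t, of "block b"] by (simp add: block_L block_scaleR r_def)
    then have "t = 1"
      using b unfolding r_def scaleR_cancel_right by blast
    then have \<rho>: "\<rho> = L b r"
      using t by simp
    have "extreme_ray (dual_polyhedron W (q (e b))) r"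
      unfolding extreme_ray_iff_sum rec
    proof (intro conjI ballI impI)
      show "r \<noteq> 0" "r \<in> K"
        using b \<open>r \<in> K\<close> by (simp_all add: r_def)
      fix x y
      assume xy: "x \<in> K" "y \<in> K" "x + y \<in> {t *\<^sub>R r | t. 0 \<le> t}"
      then obtain u where u: "0 \<le> u" "x + y = u *\<^sub>R r"
        by blast
      \<comment> \<open>Lifting the decomposition to block \<open>b\<close> makes the extremality of
        \<open>\<rho>\<close> applicable; reading off block \<open>b\<close> brings the result back
        to \<open>K\<close>.\<close>
      have "L b x + L b y = u *\<^sub>R \<rho>"
        using u by (simp add: block_eq_iff block_add block_scaleR block_L \<rho>)
      then obtain t where t: "0 \<le> t" "L b x = t *\<^sub>R \<rho>"
        using split xy u L_mem by blast
      have "x = t *\<^sub>R r"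
        using arg_cong[OF t(2), of "block b"] by (simp add: block_L block_scaleR \<rho>)
      then show "x \<in> {t *\<^sub>R r | t. 0 \<le> t}"
        using t by blast
    qed
    then show "\<exists>b r. \<rho> = lift_ray e (e b) r \<and> extreme_ray (dual_polyhedron W (q (e b))) r"
      using \<rho> unfolding L_def by blast
  next
    assume "\<exists>b r. \<rho> = lift_ray e (e b) r \<and> extreme_ray (dual_polyhedron W (q (e b))) r"
    then obtain b r where \<rho>: "\<rho> = L b r" and "extreme_ray (dual_polyhedron W (q (e b))) r"
      unfolding L_def by blast
    then have nz: "r \<noteq> 0" and "r \<in> K"
      and sum: "\<forall>x\<in>K. \<forall>y\<in>K. x + y \<in> {t *\<^sub>R r | t. 0 \<le> t} \<longrightarrow>
        x \<in> {t *\<^sub>R r | t. 0 \<le> t}"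
      unfolding extreme_ray_iff_sum rec by blast+
    have split: "\<exists>t\<ge>0. x = t *\<^sub>R r"
      if "x \<in> K" "y \<in> K" "x + y = u *\<^sub>R r" "0 \<le> u" for x y u
      using sum that by fast
    \<comment> \<open>The zero vector lies on the half-line of \<open>r\<close>, so \<open>x\<close>
      and \<open>y\<close> are both nonnegative multiples of \<open>r\<close>. Their coefficients
      add up to zero and hence vanish.\<close>
    have pointed: "x = 0" if xy: "x \<in> K" "y \<in> K" "x + y = 0" for x y
    proof -
      obtain t where t: "0 \<le> t" "x = t *\<^sub>R r"
        using split[of x y 0] xy by auto
      obtain u where u: "0 \<le> u" "y = u *\<^sub>R r"
        using split[of y x 0] xy by (auto simp: add.commute)
      have "(t + u) *\<^sub>R r = 0"
        using xy(3) t u by (simp add: scaleR_left_distrib)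
      then show ?thesis
        using nz t u by simp
    qed
    show "extreme_ray (group_dual_polyhedron W q Q e) \<rho>"
      unfolding extreme_ray_iff_sum rec_group
    proof (intro conjI ballI impI)
      show "\<rho> \<noteq> 0"
        using nz block_L[of b b r] by (auto simp: \<rho> block_zero)
      show "\<rho> \<in> G"
        using \<open>r \<in> K\<close> by (simp add: \<rho> L_mem)
      fix x y
      assume xy: "x \<in> G" "y \<in> G" "x + y \<in> {t *\<^sub>R \<rho> | t. 0 \<le> t}"
      then obtain u where u: "0 \<le> u" "x + y = u *\<^sub>R \<rho>"
        by blast
      \<comment> \<open>Block \<open>b\<close> decomposes a multiple of \<open>r\<close>, to which
        extremality applies; every other block is a pair of opposite elements of \<open>K\<close>,
        handled by \<open>pointed\<close>.\<close>
      have blocks: "block c x + block c y = (if c = b then u *\<^sub>R r else 0)" for c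
        using arg_cong[OF u(2), of "block c"] by (simp add: \<rho> block_add block_scaleR block_L)
      have K: "block c x \<in> K" "block c y \<in> K" for c
        using xy by (simp_all add: G_def)
      obtain t where t: "0 \<le> t" "block b x = t *\<^sub>R r"
        using split[OF K[of b]] blocks[of b] u by auto
      moreover have "block c x = 0" if "c \<noteq> b" for c
        using pointed[OF K[of c]] blocks[of c] that by simp
      ultimately have "x = t *\<^sub>R \<rho>"
        by (simp add: block_eq_iff \<rho> block_scaleR block_L)
      then show "x \<in> {t *\<^sub>R \<rho> | t. 0 \<le> t}"
        using t by blast
    qed
  qed
qed

section \<open>Feasibility cuts\<close>

text \<open>When the inner product is summed block by block, only the block \<open>b\<close>
  contributes. The left-hand sides of the two cuts thus agree as functions of \<open>x\<close>,
  which is more than equality of the half-spaces.\<close>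

lemma stack_inner_lift_ray:
  assumes "inj e"
  shows "(stack e h - stack e T *v x) \<bullet> lift_ray e (e b) r = (h (e b) - T (e b) *v x) \<bullet> r"
  using assms
  by (simp add: inner_blocks block_diff block_stack block_stack_mult block_lift_ray
      if_distrib[of "inner _"] cong: if_cong)

theorem proposition3p9:
  fixes P :: "'s::finite pmf"
    and J :: nat
    and m :: "nat \<Rightarrow> nat"
    and \<Omega> :: "nat \<Rightarrow> nat \<Rightarrow> 's set"
    and Q :: "nat \<Rightarrow> nat \<Rightarrow> 's pmf"
    and W :: "real^'m^'p"
    and T :: "'s \<Rightarrow> real^'n^'p"
    and h :: "'s \<Rightarrow> real^'p"
    and q :: "'s \<Rightarrow> real^'m"
    and e :: "'b::finite \<Rightarrow> 's"
    and i j :: nat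
  assumes "refinement_chain P J m \<Omega> Q"
    and "\<And>s. dual_polyhedron W (q s) \<noteq> {}"
    and "j \<in> {1..J}" and "i \<in> {1..m j}"
    and "bij_betw e UNIV (\<Omega> j i)"
  shows "{\<rho>. extreme_ray (group_dual_polyhedron W q (Q j i) e) \<rho>} =
           {lift_ray e s r | s r. s \<in> \<Omega> j i \<and> extreme_ray (dual_polyhedron W (q s)) r} \<and>
         (\<forall>s \<in> \<Omega> j i. \<forall>r. extreme_ray (dual_polyhedron W (q s)) r \<longrightarrow>
           (\<forall>x. (stack e h - stack e T *v x) \<bullet> lift_ray e s r = (h s - T s *v x) \<bullet> r) \<and>
           feasibility_cut (stack e h) (stack e T) (lift_ray e s r) = feasibility_cut (h s) (T s) r)"
proof -
  have inj: "inj e" and range: "range e = \<Omega> j i"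
    using assms(5) by (auto simp: bij_betw_def)
  have "{\<rho>. extreme_ray (group_dual_polyhedron W q (Q j i) e) \<rho>} =
      {lift_ray e s r | s r. s \<in> \<Omega> j i \<and> extreme_ray (dual_polyhedron W (q s)) r}"
    \<comment> \<open>With the set written as \<open>range e\<close>, quantifying over its scenarios
      is quantifying over the blocks.\<close>
    unfolding range[symmetric] extreme_ray_group_dual_polyhedron_iff[OF assms(2) inj] by blast
  moreover have cut: "(stack e h - stack e T *v x) \<bullet> lift_ray e s r = (h s - T s *v x) \<bullet> r"
    if "s \<in> \<Omega> j i" for s r x
    using that stack_inner_lift_ray[OF inj] unfolding range[symmetric] by blast
  ultimately show ?thesis
    by (simp add: feasibility_cut_def)
qed

end
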